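(* Let $\mathbb{X}, \mathbb{Y}$ be real normed linear spaces and let $T \in \mathbb{B}(\mathbb{X},\mathbb{Y})$. Suppose the following conditions hold: (i) $M_T = \{\pm x_0\}$ for some $x_0 \in S_{\mathbb{X}}$. (ii) $Tx_0$ is a smooth point of $\mathbb{Y}$. (iii) Given any $\delta > 0$, if $\{H_\alpha : \alpha \in \Lambda\}$ is the collection of all hyperspaces of $\mathbb{X}$ such that $d(x_0, H_\alpha) > \delta$, then $\sup\{\|Tx\| : x \in (\cup_{\alpha} H_\alpha) \cap S_{\mathbb{X}}\} < \|T\|$. Then $T$ is smooth, i.e. $T$ is a smooth point of $\mathbb{B}(\mathbb{X},\mathbb{Y})$.
   Context: All normed linear spaces are real. $\mathbb{B}(\mathbb{X},\mathbb{Y})$ is the space of bounded linear operators from $\mathbb{X}$ to $\mathbb{Y}$ with the operator norm. $B_{\mathbb{Z}}$ and $S_{\mathbb{Z}}$ denote the closed unit ball and the unit sphere of a normed linear space $\mathbb{Z}$. $M_T = \{x \in S_{\mathbb{X}} : \|Tx\| = \|T\|\}$. A hyperspace of $\mathbb{X}$ is a linear subspace of codimension one, and $d(x_0, H) = \inf\{\|x_0 - h\| : h \in H\}$. When the set over which the supremum is taken is empty, the strict inequality is regarded as vacuously satisfied. An element $x \in S_{\mathbb{Z}}$ is a smooth point if there exists a unique supporting hyperplane to $B_{\mathbb{Z}}$ at $x$ (equivalently, a unique norm-one functional $f \in \mathbb{Z}^*$ with $f(x) = \|x\|$); a nonzero element $z$ is called smooth if $z/\|z\|$ is a smooth point. 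*)

theory Defs
  imports "HOL-Analysis.Analysis"
begin

definition norm_attainment_set ::
  "('a::real_normed_vector \<Rightarrow>\<^sub>L 'b::real_normed_vector) \<Rightarrow> 'a set" where
  "norm_attainment_set T = {x \<in> sphere 0 1. norm (blinfun_apply T x) = norm T}"

(* Hyperspaces are not required to be closed; the span condition says that the quotient by H
   is one-dimensional. *)
definition hyperspace :: "'a::real_normed_vector set \<Rightarrow> bool" where
  "hyperspace H \<longleftrightarrow> subspace H \<and> (\<exists>v. v \<notin> H \<and> span (insert v H) = UNIV)"

(* A nonzero linear functional that is bounded above on the unit ball is automatically bounded,
   so ranging over bounded functionals only is no restriction. *)
definition supporting_hyperplane_at :: "'a::real_normed_vector \<Rightarrow> 'a set \<Rightarrow> bool" where
  "supporting_hyperplane_at x P \<longleftrightarrow>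
     x \<in> P \<and>
     (\<exists>(f :: 'a \<Rightarrow>\<^sub>L real) c. f \<noteq> 0 \<and> P = {y. blinfun_apply f y = c} \<and>
        (\<forall>z \<in> cball 0 1. blinfun_apply f z \<le> c))"

definition smooth_point :: "'a::real_normed_vector \<Rightarrow> bool" where
  "smooth_point x \<longleftrightarrow> x \<in> sphere 0 1 \<and> (\<exists>!P. supporting_hyperplane_at x P)"

definition smooth :: "'a::real_normed_vector \<Rightarrow> bool" where
  "smooth z \<longleftrightarrow> z \<noteq> 0 \<and> smooth_point (z /\<^sub>R norm z)"

lemma supporting_hyperplane_at_iff:
  fixes x :: "'a::real_normed_vector"
  assumes x: "norm x = 1"
  shows "supporting_hyperplane_at x P \<longleftrightarrow>
    (\<exists>g :: 'a \<Rightarrow>\<^sub>L real. norm g = 1 \<and> blinfun_apply g x = 1 \<and> P = {y. blinfun_apply g y = 1})"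
proof
  assume "supporting_hyperplane_at x P"
  then obtain f :: "'a \<Rightarrow>\<^sub>L real" and c where f: "f \<noteq> 0" and P: "P = {y. blinfun_apply f y = c}"
    and c: "\<And>z. norm z \<le> 1 \<Longrightarrow> blinfun_apply f z \<le> c" and "x \<in> P"
    unfolding supporting_hyperplane_at_def by auto
  then have fx: "blinfun_apply f x = c" by simp
  have nf: "norm f > 0" using f by simp
  have ab: "\<bar>blinfun_apply f z\<bar> \<le> c" if "norm z \<le> 1" for z
    using c[of z] c[of "-z"] that by (simp add: blinfun.minus_right)
  have c0: "0 \<le> c" using ab[of 0] by simp
  have "norm f \<le> c"
  proof (rule norm_blinfun_bound[OF c0])
    fix z show "norm (blinfun_apply f z) \<le> c * norm z"
    proof (cases "z = 0")
      case False
      then show ?thesis using ab[of "z /\<^sub>R norm z"]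
        by (simp add: blinfun.scaleR_right abs_mult field_simps)
    qed simp
  qed
  moreover have "c \<le> norm f" using norm_blinfun[of f x] fx x by simp
  ultimately have ceq: "c = norm f" by simp
  show "\<exists>g :: 'a \<Rightarrow>\<^sub>L real. norm g = 1 \<and> blinfun_apply g x = 1 \<and> P = {y. blinfun_apply g y = 1}"
    by (rule exI[of _ "f /\<^sub>R norm f"]) (use nf fx in \<open>auto simp: P ceq blinfun.scaleR_left field_simps\<close>)
next
  assume "\<exists>g :: 'a \<Rightarrow>\<^sub>L real. norm g = 1 \<and> blinfun_apply g x = 1 \<and> P = {y. blinfun_apply g y = 1}"
  then obtain g :: "'a \<Rightarrow>\<^sub>L real" where g: "norm g = 1" "blinfun_apply g x = 1"
    "P = {y. blinfun_apply g y = 1}" by blast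
  have "blinfun_apply g z \<le> 1" if "norm z \<le> 1" for z
    using norm_blinfun[of g z] g that by simp
  then show "supporting_hyperplane_at x P"
    unfolding supporting_hyperplane_at_def using g
    by (auto intro!: exI[of _ g] exI[of _ "1::real"])
qed

lemma blinfun_eq_if_level_set_eq:
  fixes g h :: "'a::real_normed_vector \<Rightarrow>\<^sub>L real"
  assumes "{y. blinfun_apply g y = 1} = {y. blinfun_apply h y = 1}"
  shows "g = h"
proof (rule blinfun_eqI)
  have iff: "blinfun_apply g y = 1 \<longleftrightarrow> blinfun_apply h y = 1" for y using assms by blast
  fix y show "blinfun_apply g y = blinfun_apply h y"
    using iff[of "y /\<^sub>R blinfun_apply g y"] iff[of "y /\<^sub>R blinfun_apply h y"]
    by (cases "blinfun_apply g y = 0"; cases "blinfun_apply h y = 0")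
       (simp_all add: blinfun.scaleR_right field_simps)
qed

lemma smooth_point_iff:
  fixes x :: "'a::real_normed_vector"
  assumes x: "norm x = 1"
  shows "smooth_point x \<longleftrightarrow>
    (\<exists>!f :: 'a \<Rightarrow>\<^sub>L real. norm f = 1 \<and> blinfun_apply f x = norm x)"
proof -
  have "(\<exists>!P. supporting_hyperplane_at x P) \<longleftrightarrow>
    (\<exists>!f :: 'a \<Rightarrow>\<^sub>L real. norm f = 1 \<and> blinfun_apply f x = 1)"
    unfolding supporting_hyperplane_at_iff[OF x]
    using blinfun_eq_if_level_set_eq[where 'a='a] by (smt (verit, best))
  then show ?thesis using x by (simp add: smooth_point_def)
qed

lemma smooth_iff:
  fixes z :: "'a::real_normed_vector"
  assumes "z \<noteq> 0"
  shows "smooth z \<longleftrightarrow>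
    (\<exists>!f :: 'a \<Rightarrow>\<^sub>L real. norm f = 1 \<and> blinfun_apply f z = norm z)"
proof -
  have n: "norm (z /\<^sub>R norm z) = 1" using assms by simp
  have "blinfun_apply f (z /\<^sub>R norm z) = norm (z /\<^sub>R norm z) \<longleftrightarrow> blinfun_apply f z = norm z"
    for f :: "'a \<Rightarrow>\<^sub>L real"
    unfolding n using assms by (auto simp: blinfun.scaleR_right field_simps)
  then show ?thesis using smooth_point_iff[OF n] assms by (simp only: smooth_def) simp
qed

end

theory Submission
  imports Defs
begin

text \<open>
  If \<open>g\<close> is the supporting functional at \<open>T x\<^sub>0\<close>, then \<open>S \<mapsto> g (S x\<^sub>0)\<close> supports the unit ball of the
  operator space at \<open>T\<close>, so only uniqueness is at stake. A supporting functional \<open>F\<close> satisfies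
  \<open>\<parallel>T\<parallel> + t F(S) \<le> \<parallel>T + t S\<parallel>\<close>, hence it suffices that
  \<open>\<parallel>T + t S\<parallel> \<le> \<parallel>T\<parallel> + t (g (S x\<^sub>0) + e)\<close> for some \<open>t > 0\<close>. Near \<open>\<plusminus>x\<^sub>0\<close> this holds because smoothness
  makes \<open>g\<close> the directional derivative of the norm at \<open>T x\<^sub>0\<close>. By Hahn--Banach, a unit vector away
  from \<open>\<plusminus>x\<^sub>0\<close> lies in a hyperspace at a definite distance from \<open>x\<^sub>0\<close>, so there the norm of \<open>T x\<close> is
  bounded away from \<open>\<parallel>T\<parallel>\<close> and small \<open>t\<close> do no harm.
  The linear functionals in Hahn--Banach arise as minimal sublinear ones, by Zorn's lemma.
\<close>

section \<open>Sublinear functionals and the Hahn--Banach theorem\<close>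

definition sublinear :: "('a::real_vector \<Rightarrow> real) \<Rightarrow> bool" where
  "sublinear p \<longleftrightarrow> (\<forall>x y. p (x + y) \<le> p x + p y) \<and> (\<forall>c\<ge>0. \<forall>x. p (c *\<^sub>R x) = c * p x)"

lemma sublinear_add: "sublinear p \<Longrightarrow> p (x + y) \<le> p x + p y"
  by (simp add: sublinear_def)

lemma sublinear_scale: "sublinear p \<Longrightarrow> 0 \<le> c \<Longrightarrow> p (c *\<^sub>R x) = c * p x"
  by (simp add: sublinear_def)

lemma sublinear_0: "sublinear p \<Longrightarrow> p 0 = 0"
  using sublinear_scale[of p 0 0] by simp

lemma sublinear_minus: "sublinear p \<Longrightarrow> - p (- x) \<le> p x"
  using sublinear_add[of p x "- x"] by (simp add: sublinear_0)

lemma sublinear_norm: "sublinear norm"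
  by (simp add: sublinear_def norm_triangle_ineq)

text \<open>Applying the inequality for \<open>inverse c\<close> at \<open>c *\<^sub>R x\<close>
  yields the reverse one, so homogeneity needs only one direction.\<close>

lemma sublinearI:
  assumes add: "\<And>x y. p (x + y) \<le> p x + p y"
    and zero: "p 0 = 0"
    and scale: "\<And>c x. c > 0 \<Longrightarrow> p (c *\<^sub>R x) \<le> c * p x"
  shows "sublinear p"
proof -
  have "p (c *\<^sub>R x) = c * p x" if "c \<ge> 0" for c x
  proof (cases "c = 0")
    case False
    then have c: "c > 0" using that by simp
    have "p x \<le> inverse c * p (c *\<^sub>R x)"
      using scale[of "inverse c" "c *\<^sub>R x"] c by simp
    then have "c * p x \<le> p (c *\<^sub>R x)" using c by (simp add: field_simps)
    then show ?thesis using scale[OF c, of x] by simp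
  qed (simp add: zero)
  then show ?thesis using add by (simp add: sublinear_def)
qed

text \<open>For \<phi> superlinear on the convex cone \<open>K\<close> and below \<open>p\<close>
  there, this is the largest sublinear functional \<open>q\<close> below \<open>p\<close> with
  \<open>q (- k)\<close> at most \<open>- \<phi> k\<close> on \<open>K\<close>. Linear functionals
  below it are thus those squeezed between \<phi> on \<open>K\<close> and \<open>p\<close>.\<close>

definition cone_inf ::
  "('a::real_vector \<Rightarrow> real) \<Rightarrow> 'a set \<Rightarrow> ('a \<Rightarrow> real) \<Rightarrow> 'a \<Rightarrow> real" where
  "cone_inf p K \<phi> x = (INF k\<in>K. p (x + k) - \<phi> k)"

context
  fixes p \<phi> :: "'a::real_vector \<Rightarrow> real" and K :: "'a set"
  assumes p: "sublinear p" and K: "convex_cone K"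
    and \<phi>_add: "\<And>k l. k \<in> K \<Longrightarrow> l \<in> K \<Longrightarrow> \<phi> k + \<phi> l \<le> \<phi> (k + l)"
    and \<phi>_scale: "\<And>c k. k \<in> K \<Longrightarrow> 0 \<le> c \<Longrightarrow> \<phi> (c *\<^sub>R k) = c * \<phi> k"
    and \<phi>_le: "\<And>k. k \<in> K \<Longrightarrow> \<phi> k \<le> p k"
begin

lemma cone_inf_lower: "k \<in> K \<Longrightarrow> cone_inf p K \<phi> x \<le> p (x + k) - \<phi> k"
  unfolding cone_inf_def
proof (rule cINF_lower)
  \<comment> \<open>The infimum is finite because \<phi> k \<le> p k \<le> p (x + k) + p (-
    x).\<close>
  have "- p (- x) \<le> p (x + k) - \<phi> k" if "k \<in> K" for k
    using sublinear_add[OF p, of "x + k" "- x"] \<phi>_le[OF that] by simp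
  then show "bdd_below ((\<lambda>k. p (x + k) - \<phi> k) ` K)" by (rule bdd_belowI2)
qed

lemma cone_inf_greatest:
  "(\<And>k. k \<in> K \<Longrightarrow> m \<le> p (x + k) - \<phi> k) \<Longrightarrow> m \<le> cone_inf p K \<phi> x"
  unfolding cone_inf_def using K by (intro cINF_greatest) (auto simp: convex_cone_def)

lemma cone_inf_le: "cone_inf p K \<phi> x \<le> p x"
  using cone_inf_lower[of 0 x] K \<phi>_scale[of 0 0] by (simp add: convex_cone_iff)

lemma cone_inf_uminus_le: "k \<in> K \<Longrightarrow> cone_inf p K \<phi> (- k) \<le> - \<phi> k"
  using cone_inf_lower[of k "- k"] by (simp add: sublinear_0[OF p])

text \<open>Competitors \<open>k\<close> for \<open>x\<close> and \<open>l\<close> for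
  \<open>y\<close> combine to \<open>k + l\<close> for \<open>x + y\<close>, and \<open>k\<close>
  rescales to \<open>c *\<^sub>R k\<close>.\<close>

lemma sublinear_cone_inf: "sublinear (cone_inf p K \<phi>)"
proof (rule sublinearI)
  fix x y
  have "cone_inf p K \<phi> (x + y) \<le> (p (x + k) - \<phi> k) + (p (y + l) - \<phi> l)"
    if "k \<in> K" "l \<in> K" for k l
  proof -
    have "cone_inf p K \<phi> (x + y) \<le> p ((x + y) + (k + l)) - \<phi> (k + l)"
      using that K by (intro cone_inf_lower) (simp add: convex_cone_iff)
    moreover have "p ((x + y) + (k + l)) \<le> p (x + k) + p (y + l)"
      using sublinear_add[OF p, of "x + k" "y + l"] by (simp add: algebra_simps)
    ultimately show ?thesis using \<phi>_add[OF that] by linarith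
  qed
  \<comment> \<open>The infima are taken one at a time: over \<open>k\<close> with \<open>l\<close>
    fixed, then over \<open>l\<close>.\<close>
  then have "cone_inf p K \<phi> (x + y) - (p (y + l) - \<phi> l) \<le> cone_inf p K \<phi> x"
    if "l \<in> K" for l
    using that by (intro cone_inf_greatest) (simp add: algebra_simps)
  then have "cone_inf p K \<phi> (x + y) - cone_inf p K \<phi> x \<le> cone_inf p K \<phi> y"
    by (intro cone_inf_greatest) (simp add: algebra_simps)
  then show "cone_inf p K \<phi> (x + y) \<le> cone_inf p K \<phi> x + cone_inf p K \<phi> y" by simp
next
  have "0 \<le> cone_inf p K \<phi> 0" by (rule cone_inf_greatest) (simp add: \<phi>_le)
  then show "cone_inf p K \<phi> 0 = 0" using cone_inf_le[of 0] sublinear_0[OF p] by simp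
next
  fix c :: real and x :: 'a
  assume c: "c > 0"
  have "cone_inf p K \<phi> (c *\<^sub>R x) \<le> c * (p (x + k) - \<phi> k)" if k: "k \<in> K" for k
  proof -
    have "cone_inf p K \<phi> (c *\<^sub>R x) \<le> p (c *\<^sub>R x + c *\<^sub>R k) - \<phi> (c *\<^sub>R k)"
      using k K c by (intro cone_inf_lower) (simp add: convex_cone_iff)
    also have "\<dots> = c * (p (x + k) - \<phi> k)"
      using sublinear_scale[OF p, of c "x + k"] \<phi>_scale[OF k, of c] c
      by (simp add: algebra_simps)
    finally show ?thesis .
  qed
  then have "cone_inf p K \<phi> (c *\<^sub>R x) / c \<le> cone_inf p K \<phi> x"
    using c by (intro cone_inf_greatest) (simp add: field_simps)
  then show "cone_inf p K \<phi> (c *\<^sub>R x) \<le> c * cone_inf p K \<phi> x"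
    using c by (simp add: field_simps)
qed

end

abbreviation ray :: "'a::real_vector \<Rightarrow> 'a set" where
  "ray y \<equiv> (\<lambda>t. t *\<^sub>R y) ` {0..}"

lemma convex_cone_ray: "convex_cone (ray y)"
  by (force simp: convex_cone_iff image_iff simp flip: scaleR_left_distrib)

lemma ray_self: "y \<in> ray y"
  by (rule image_eqI[of _ _ 1]) auto

text \<open>Up to the substitution \<open>s = 1/t\<close>, the functional \<open>cone_inf p (ray y) p\<close> is the right
  directional derivative of \<open>p\<close> at \<open>y\<close>.\<close>
lemma
  assumes p: "sublinear p"
  shows sublinear_cone_inf_ray: "sublinear (cone_inf p (ray y) p)"
    and cone_inf_ray_le: "cone_inf p (ray y) p x \<le> p x"
    and cone_inf_ray_lower: "cone_inf p (ray y) p x \<le> p (x + y) - p y"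
    and cone_inf_ray_uminus: "cone_inf p (ray y) p (- y) \<le> - p y"
proof -
  have add: "p k + p l \<le> p (k + l)" if kl: "k \<in> ray y" "l \<in> ray y" for k l
  proof -
    from kl obtain s t where "0 \<le> s" "0 \<le> t" "k = s *\<^sub>R y" "l = t *\<^sub>R y" by auto
    then show ?thesis using p
      by (simp add: sublinear_scale distrib_right flip: scaleR_left_distrib)
  qed
  note facts = p convex_cone_ray add sublinear_scale[OF p] order_refl
  show "sublinear (cone_inf p (ray y) p)" by (rule sublinear_cone_inf[OF facts])
  show "cone_inf p (ray y) p x \<le> p x" by (rule cone_inf_le[OF facts])
  show "cone_inf p (ray y) p x \<le> p (x + y) - p y"
    by (rule cone_inf_lower[OF facts ray_self])
  show "cone_inf p (ray y) p (- y) \<le> - p y" by (rule cone_inf_uminus_le[OF facts ray_self])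
qed

text \<open>Infima of sublinear functionals need not be subadditive; in a chain, the two members
  used at \<open>x\<close> and at \<open>y\<close> can be replaced by the smaller one. The common
  bound \<open>r\<close> keeps the infimum finite.\<close>

lemma sublinear_INF_chain:
  assumes C: "C \<noteq> {}" "\<And>p. p \<in> C \<Longrightarrow> sublinear p" "\<And>p. p \<in> C \<Longrightarrow> p \<le> r"
    and chain: "\<And>p q. p \<in> C \<Longrightarrow> q \<in> C \<Longrightarrow> p \<le> q \<or> q \<le> p"
  defines "u \<equiv> \<lambda>x. INF p\<in>C. p x"
  shows "sublinear u" and "\<And>p. p \<in> C \<Longrightarrow> u \<le> p"
proof -
  have lower: "u x \<le> p x" if "p \<in> C" for p x
    unfolding u_def using _ that
  proof (rule cINF_lower)
    have "- r (- x) \<le> p x" if "p \<in> C" for p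
      using sublinear_minus[OF C(2)[OF that], of x] C(3)[OF that] le_funD[of p r "- x"]
      by linarith
    then show "bdd_below ((\<lambda>p. p x) ` C)" by (rule bdd_belowI2)
  qed
  then show "u \<le> p" if "p \<in> C" for p using that by (simp add: le_fun_def)
  have greatest: "m \<le> u x" if "\<And>p. p \<in> C \<Longrightarrow> m \<le> p x" for m x
    unfolding u_def using C(1) that by (rule cINF_greatest)
  show "sublinear u"
  proof (rule sublinearI)
    fix x y
    have "u (x + y) \<le> p x + q y" if pq: "p \<in> C" "q \<in> C" for p q
    proof -
      obtain m where m: "m \<in> C" "m \<le> p" "m \<le> q" using chain[OF pq] pq by auto
      have "u (x + y) \<le> m x + m y"
        using lower[OF m(1)] sublinear_add[OF C(2)[OF m(1)]] order_trans by blast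
      then show ?thesis using le_funD[OF m(2), of x] le_funD[OF m(3), of y] by linarith
    qed
    then have "u (x + y) - q y \<le> u x" if "q \<in> C" for q
      using that by (intro greatest) (simp add: algebra_simps)
    then have "u (x + y) - u x \<le> u y"
      by (intro greatest) (simp add: algebra_simps)
    then show "u (x + y) \<le> u x + u y" by simp
  next
    show "u 0 = 0" using C(1,2) by (simp add: u_def sublinear_0 cong: INF_cong)
  next
    fix c :: real and x
    assume c: "c > 0"
    have "u (c *\<^sub>R x) \<le> c * p x" if "p \<in> C" for p
      using lower[OF that, of "c *\<^sub>R x"] sublinear_scale[OF C(2)[OF that], of c x] c by simp
    then have "u (c *\<^sub>R x) / c \<le> u x"
      using c by (intro greatest) (simp add: field_simps)
    then show "u (c *\<^sub>R x) \<le> c * u x" using c by (simp add: field_simps)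
  qed
qed

text \<open>Minimality forces \<open>cone_inf p (ray y) p = p\<close> for every \<open>y\<close>,
  which makes \<open>p\<close> superadditive as well.\<close>

lemma minimal_sublinear_linear:
  assumes p: "sublinear p"
    and minimal: "\<And>q. sublinear q \<Longrightarrow> q \<le> p \<Longrightarrow> q = p"
  shows "linear p"
proof -
  have "cone_inf p (ray y) p = p" for y
    using sublinear_cone_inf_ray[OF p] cone_inf_ray_le[OF p] by (intro minimal) (auto simp: le_fun_def)
  then have "p x \<le> p (x + y) - p y" for x y
    using cone_inf_ray_lower[OF p] by metis
  then have add: "p (x + y) = p x + p y" for x y
    using sublinear_add[OF p, of x y] by (simp add: order_antisym algebra_simps)
  have minus: "p (- x) = - p x" for x using add[of x "- x"] sublinear_0[OF p] by simp
  have "p (c *\<^sub>R x) = c * p x" for c x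
    using sublinear_scale[OF p, of c x] sublinear_scale[OF p, of "- c" x] minus[of "c *\<^sub>R x"]
    by (cases "c \<ge> 0") auto
  then show ?thesis using add by (intro linearI) auto
qed

lemma linear_below_sublinear:
  assumes r: "sublinear r"
  obtains f where "linear f" "f \<le> r"
proof -
  define A where "A = {p. sublinear p \<and> p \<le> r}"
  \<comment> \<open>Zorn's lemma for the reversed order: a maximal element is a minimal sublinear
    functional, and chains are bounded by their pointwise infimum, the empty chain by
    \<open>r\<close>.\<close>
  have "\<exists>m\<in>A. \<forall>p\<in>A. m \<ge> p \<longrightarrow> p = m"
  proof (rule predicate_Zorn)
    show "partial_order_on A (relation_of (\<ge>) A)"
      by (rule partial_order_on_relation_ofI) auto
  next
    fix C assume "C \<in> Chains (relation_of (\<ge>) A)"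
    then have CA: "C \<subseteq> A" and chain: "\<And>p q. p \<in> C \<Longrightarrow> q \<in> C \<Longrightarrow> p \<le> q \<or> q \<le> p"
      by (auto simp: Chains_def relation_of_def)
    show "\<exists>u\<in>A. \<forall>p\<in>C. p \<ge> u"
    proof (cases "C = {}")
      case True
      then show ?thesis using r by (auto simp: A_def)
    next
      case False
      have C: "\<And>p. p \<in> C \<Longrightarrow> sublinear p" "\<And>p. p \<in> C \<Longrightarrow> p \<le> r" using CA by (auto simp: A_def)
      note u = sublinear_INF_chain[OF False C chain]
      from False obtain p where "p \<in> C" by blast
      then have "(\<lambda>x. INF p\<in>C. p x) \<le> r" using u(2) C(2) order_trans by blast
      then have "(\<lambda>x. INF p\<in>C. p x) \<in> A" using u(1) by (simp add: A_def)
      then show ?thesis using u(2) by blast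
    qed
  qed
  then obtain m where m: "m \<in> A" and min: "\<And>p. p \<in> A \<Longrightarrow> p \<le> m \<Longrightarrow> p = m" by blast
  have "linear m"
    using m min by (intro minimal_sublinear_linear) (auto simp: A_def intro: order_trans)
  then show thesis using m that by (simp add: A_def)
qed

text \<open>A linear functional below \<open>cone_inf p (ray y) p\<close> is at most
  \<open>- p y\<close> at \<open>- y\<close>, hence at least \<open>p y\<close> at
  \<open>y\<close>.\<close>

lemma linear_below_sublinear_touching:
  assumes p: "sublinear p"
  obtains f where "linear f" "f \<le> p" "f y = p y"
proof -
  obtain f where f: "linear f" "f \<le> cone_inf p (ray y) p"
    using linear_below_sublinear[OF sublinear_cone_inf_ray[OF p]] by blast
  have "- f y \<le> - p y"
    using le_funD[OF f(2), of "- y"] cone_inf_ray_uminus[OF p, of y] linear_neg[OF f(1), of y]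
    by linarith
  moreover have "f \<le> p"
    using f(2) cone_inf_ray_le[OF p, of y] by (auto simp: le_fun_def intro: order_trans)
  ultimately show thesis using that[OF f(1)] le_funD[of f p y] by force
qed

lemma linear_le_norm_blinfun:
  assumes "linear f" and le: "f \<le> norm"
  obtains g :: "'a::real_normed_vector \<Rightarrow>\<^sub>L real"
  where "blinfun_apply g = f" "norm g \<le> 1"
proof -
  have abs: "\<bar>f x\<bar> \<le> norm x" for x
    using le_funD[OF le, of x] le_funD[OF le, of "- x"] linear_neg[OF assms(1), of x] by auto
  then have "bounded_linear f"
    using assms(1) by (intro bounded_linear_intro[where K = 1]) (auto simp: linear_add linear_scale)
  then have app: "blinfun_apply (Blinfun f) = f" by (rule bounded_linear_Blinfun_apply)
  then have "norm (Blinfun f) \<le> 1" using abs by (intro norm_blinfun_bound) auto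
  then show thesis using app that by blast
qed

lemma hyperspace_kernel:
  assumes f: "linear f" and v: "f v \<noteq> (0::real)"
  shows "hyperspace {x. f x = 0}"
proof -
  have "x \<in> span (insert v {x. f x = 0})" for x
  proof -
    have "x - (f x / f v) *\<^sub>R v \<in> span {x. f x = 0}"
      using v by (intro span_base) (simp add: linear_diff[OF f] linear_scale[OF f])
    then show ?thesis by (auto simp: span_breakdown_eq)
  qed
  moreover have "subspace {x. f x = 0}"
    by (rule subspaceI) (auto simp: linear_0[OF f] linear_add[OF f] linear_scale[OF f])
  ultimately show ?thesis using v unfolding hyperspace_def by blast
qed

text \<open>\<open>H\<close> is the kernel of a linear \<open>f\<close> that vanishes on the line
  through \<open>x\<close>, lies below the norm and has f x0 \<ge> d.\<close>

lemma hyperspace_far_from_point: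
  fixes x0 x :: "'a::real_normed_vector"
  assumes "d > 0" and d: "\<And>a. d \<le> norm (x0 - a *\<^sub>R x)"
  obtains H where "hyperspace H" "x \<in> H" "d \<le> infdist x0 H"
proof -
  \<comment> \<open>\<open>q z\<close> is the distance from \<open>z\<close> to the line spanned by
    \<open>x\<close>.\<close>
  define q where "q = cone_inf norm (span {x}) (\<lambda>_. 0)"
  have facts: "sublinear (norm :: 'a \<Rightarrow> real)" "convex_cone (span {x})"
    by (simp_all add: sublinear_norm convex_cone_span)
  have q: "sublinear q" unfolding q_def by (rule sublinear_cone_inf[OF facts]) auto
  have q_le: "q z \<le> norm z" for z unfolding q_def by (rule cone_inf_le[OF facts]) auto
  have q_span: "q z \<le> 0" if "z \<in> span {x}" for z
    using cone_inf_uminus_le[OF facts, of "\<lambda>_. 0" "- z"] span_neg[OF that] by (simp add: q_def)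
  have "d \<le> q x0"
    unfolding q_def
  proof (rule cone_inf_greatest[OF facts])
    fix k assume "k \<in> span {x}"
    then obtain a where "k = a *\<^sub>R x" by (auto simp: span_singleton)
    then show "d \<le> norm (x0 + k) - 0" using d[of "- a"] by simp
  qed auto
  moreover obtain f where f: "linear f" "f \<le> q" "f x0 = q x0"
    by (rule linear_below_sublinear_touching[OF q])
  ultimately have fx0: "d \<le> f x0" by simp
  define H where "H = {z. f z = 0}"
  show thesis
  proof
    show "hyperspace H" unfolding H_def using fx0 \<open>d > 0\<close> by (intro hyperspace_kernel[OF f(1), of x0]) auto
    have "f x \<le> 0" "f (- x) \<le> 0"
      using le_funD[OF f(2)] q_span by (meson order_trans span_base span_neg singletonI)+
    then show "x \<in> H" using linear_neg[OF f(1), of x] by (simp add: H_def)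
    \<comment> \<open>\<open>infdist\<close> to the empty set is 0 by convention, so nonemptiness
      matters.\<close>
    then have "H \<noteq> {}" by blast
    moreover have "d \<le> dist x0 h" if "h \<in> H" for h
    proof -
      have "f x0 = f (x0 - h)" using that by (simp add: H_def linear_diff[OF f(1)])
      also have "\<dots> \<le> norm (x0 - h)" using le_funD[OF f(2)] q_le order_trans by blast
      finally show ?thesis using fx0 by (simp add: dist_norm)
    qed
    ultimately show "d \<le> infdist x0 H"
      by (auto simp: infdist_def intro: cINF_greatest)
  qed
qed

section \<open>The directional derivative of the norm at a smooth point\<close>

text \<open>Every linear functional below the directional derivative at \<open>y\<close> is a
  norm-one supporting functional at \<open>y\<close>, hence is \<open>g\<close>; one of them attains
  the derivative at \<open>v\<close>.\<close>

lemma smooth_cone_inf_ray_norm: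
  fixes y v :: "'a::real_normed_vector"
  assumes "smooth y" and g: "norm (g :: 'a \<Rightarrow>\<^sub>L real) = 1" "g y = norm y"
  shows "cone_inf norm (ray y) norm v = g v"
proof -
  have y: "y \<noteq> 0" using \<open>smooth y\<close> by (simp add: smooth_def)
  obtain f where f: "linear f" "f \<le> cone_inf norm (ray y) norm"
      "f v = cone_inf norm (ray y) norm v"
    using linear_below_sublinear_touching[OF sublinear_cone_inf_ray[OF sublinear_norm, of y], of v] .
  have "f \<le> norm"
    using f(2) cone_inf_ray_le[OF sublinear_norm, of y] by (auto simp: le_fun_def intro: order_trans)
  then obtain h :: "'a \<Rightarrow>\<^sub>L real" where h: "blinfun_apply h = f" "norm h \<le> 1"
    using linear_le_norm_blinfun[OF f(1)] by blast
  have "- f y \<le> - norm y"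
    using le_funD[OF f(2), of "- y"] cone_inf_ray_uminus[OF sublinear_norm, of y]
      linear_neg[OF f(1), of y] by linarith
  moreover have hy: "\<bar>f y\<bar> \<le> norm h * norm y" using norm_blinfun[of h y] h(1) by simp
  moreover have "norm h * norm y \<le> norm y" using h(2) by (simp add: mult_left_le_one_le)
  ultimately have "f y = norm y" "norm h * norm y = norm y" by linarith+
  then have "norm h = 1" "h y = norm y" using y h(1) by auto
  then have "h = g" using smooth_iff[OF y] \<open>smooth y\<close> g by blast
  then show ?thesis using f(3) h(1) by simp
qed

lemma smooth_norm_upper_derivative:
  fixes y v :: "'a::real_normed_vector"
  assumes y: "smooth y" and g: "norm (g :: 'a \<Rightarrow>\<^sub>L real) = 1" "g y = norm y" and r: "g v < r"
  obtains s where "s > 0" "norm (y + s *\<^sub>R v) < norm y + s * r"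
proof -
  have "(INF k\<in>ray y. norm (v + k) - norm k) < r"
    using smooth_cone_inf_ray_norm[OF y g, of v] r by (simp add: cone_inf_def)
  then obtain t where t: "t \<ge> 0" "norm (v + t *\<^sub>R y) - norm (t *\<^sub>R y) < r"
    by (auto dest!: cInf_lessD[rotated])
  show thesis
  proof (cases "t = 0")
    \<comment> \<open>Here \<open>norm v < r\<close>, and the triangle inequality allows any step,
      such as 1.\<close>
    case True
    then show thesis using t norm_triangle_ineq[of y v] by (intro that[of 1]) auto
  next
    case False
    with t have "t > 0" by simp
    have "y + inverse t *\<^sub>R v = inverse t *\<^sub>R (v + t *\<^sub>R y)"
      using \<open>t > 0\<close> by (simp add: algebra_simps)
    then have "norm (y + inverse t *\<^sub>R v) = inverse t * norm (v + t *\<^sub>R y)"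
      using \<open>t > 0\<close> by simp
    then show thesis using t(2) \<open>t > 0\<close> by (intro that[of "inverse t"]) (auto simp: field_simps)
  qed
qed

text \<open>The strict inequality at a single step \<open>s\<close> survives small changes of the
  base point, and convexity of the norm carries it to all shorter steps.\<close>

lemma smooth_norm_upper_derivative_locally:
  fixes y v :: "'a::real_normed_vector"
  assumes "smooth y" "norm (g :: 'a \<Rightarrow>\<^sub>L real) = 1" "g y = norm y" "g v < r"
  obtains \<eta> s where "\<eta> > 0" "s > 0"
    "\<And>w t. norm (w - y) < \<eta> \<Longrightarrow> 0 \<le> t \<Longrightarrow> t \<le> s \<Longrightarrow> norm (w + t *\<^sub>R v) \<le> norm w + t * r"
proof -
  obtain s where s: "s > 0" "norm (y + s *\<^sub>R v) < norm y + s * r"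
    using smooth_norm_upper_derivative[OF assms] .
  \<comment> \<open>Half the slack, since \<open>norm (w - y)\<close> enters twice: in moving
    \<open>y + s *\<^sub>R v\<close> and in moving \<open>y\<close>.\<close>
  define \<eta> where "\<eta> = (norm y + s * r - norm (y + s *\<^sub>R v)) / 2"
  have "norm (w + t *\<^sub>R v) \<le> norm w + t * r" if w: "norm (w - y) < \<eta>" and t: "0 \<le> t" "t \<le> s" for w t
  proof -
    have "norm (w + s *\<^sub>R v) \<le> norm (y + s *\<^sub>R v) + norm (w - y)"
      using norm_triangle_ineq[of "y + s *\<^sub>R v" "w - y"] by (simp add: algebra_simps)
    moreover have "norm y \<le> norm w + norm (w - y)"
      using norm_triangle_ineq2[of y w] by (simp add: norm_minus_commute)
    ultimately have le: "norm (w + s *\<^sub>R v) \<le> norm w + s * r" using w by (simp add: \<eta>_def)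
    define c where "c = t / s"
    have c: "0 \<le> c" "c \<le> 1" "c * s = t" using t s by (auto simp: c_def)
    have "w + t *\<^sub>R v = (1 - c) *\<^sub>R w + c *\<^sub>R (w + s *\<^sub>R v)"
      using c by (simp add: algebra_simps)
    then have "norm (w + t *\<^sub>R v) \<le> (1 - c) * norm w + c * norm (w + s *\<^sub>R v)"
      using norm_triangle_ineq[of "(1 - c) *\<^sub>R w" "c *\<^sub>R (w + s *\<^sub>R v)"] c by simp
    also have "\<dots> \<le> (1 - c) * norm w + c * (norm w + s * r)"
      using le c by (intro add_left_mono mult_left_mono)
    also have "\<dots> = norm w + (c * s) * r" by (simp add: algebra_simps)
    finally show ?thesis using c by simp
  qed
  moreover have "\<eta> > 0" using s by (simp add: \<eta>_def)
  ultimately show thesis using that s(1) by blast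
qed

section \<open>Smoothness of the operator\<close>

text \<open>The point \<open>a *\<^sub>R x\<close> is no farther from the unit vector
  \<open>x\<close> or \<open>- x\<close> of its own sign than from \<open>x0\<close>; the triangle
  inequality then costs a factor 2.\<close>

lemma unit_vector_line_distance:
  fixes x x0 :: "'a::real_normed_vector"
  assumes "norm x = 1" "norm x0 = 1" and far: "\<eta> \<le> norm (x - x0)" "\<eta> \<le> norm (x + x0)"
  shows "\<eta> / 2 \<le> norm (x0 - a *\<^sub>R x)"
proof -
  define \<sigma> :: real where "\<sigma> = (if a \<ge> 0 then 1 else - 1)"
  have "\<bar>1 - \<bar>a\<bar>\<bar> \<le> norm (x0 - a *\<^sub>R x)"
    using norm_triangle_ineq3[of x0 "a *\<^sub>R x"] assms by simp
  moreover have "norm (a *\<^sub>R x - \<sigma> *\<^sub>R x) = \<bar>1 - \<bar>a\<bar>\<bar>"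
    using assms by (auto simp: \<sigma>_def simp flip: scaleR_left_diff_distrib scaleR_left_distrib)
  moreover have "norm (x0 - \<sigma> *\<^sub>R x) \<le> norm (x0 - a *\<^sub>R x) + norm (a *\<^sub>R x - \<sigma> *\<^sub>R x)"
    using norm_triangle_ineq[of "x0 - a *\<^sub>R x" "a *\<^sub>R x - \<sigma> *\<^sub>R x"] by simp
  moreover have "\<eta> \<le> norm (x0 - \<sigma> *\<^sub>R x)"
    using far by (simp add: \<sigma>_def norm_minus_commute add.commute)
  ultimately show ?thesis by linarith
qed

theorem theorem3p2:
  fixes T :: "'a::real_normed_vector \<Rightarrow>\<^sub>L 'b::real_normed_vector"
    and x0 :: 'a
  assumes "x0 \<in> sphere 0 1"
    and "norm_attainment_set T = {x0, - x0}"
    and "smooth (blinfun_apply T x0)"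
    and "\<And>\<delta> :: real. \<delta> > 0 \<Longrightarrow>
      (let A = \<Union>{H. hyperspace H \<and> infdist x0 H > \<delta>} \<inter> sphere 0 1
       in A = {} \<or> (SUP x\<in>A. norm (blinfun_apply T x)) < norm T)"
  shows "smooth T"
proof -
  have x0: "norm x0 = 1" using assms(1) by simp
  have Tx0: "norm (T x0) = norm T" using assms(2) by (auto simp: norm_attainment_set_def)
  have T: "T \<noteq> 0" using assms(3) by (auto simp: smooth_def)
  have gap: "\<exists>\<kappa>>0. \<forall>x. norm x = 1 \<longrightarrow> \<eta> \<le> norm (x - x0) \<longrightarrow> \<eta> \<le> norm (x + x0) \<longrightarrow>
      norm (T x) \<le> norm T - \<kappa>" if \<eta>: "\<eta> > 0" for \<eta>
  proof -
    \<comment> \<open>Hahn-Banach gives distance at least \<eta> / 2; \<eta> / 4 makes the required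
      inequality strict.\<close>
    define A where "A = \<Union>{H. hyperspace H \<and> infdist x0 H > \<eta> / 4} \<inter> sphere 0 1"
    have in_A: "x \<in> A" if x: "norm x = 1" "\<eta> \<le> norm (x - x0)" "\<eta> \<le> norm (x + x0)" for x
    proof -
      obtain H where "hyperspace H" "x \<in> H" "\<eta> / 2 \<le> infdist x0 H"
        using hyperspace_far_from_point[of "\<eta> / 2" x0 x]
          unit_vector_line_distance[OF x(1) x0 x(2,3)] \<eta> by auto
      then show ?thesis using x(1) \<eta> by (auto simp: A_def intro!: exI[of _ H])
    qed
    have bdd: "bdd_above ((\<lambda>x. norm (T x)) ` A)"
    proof (rule bdd_aboveI2)
      show "norm (T x) \<le> norm T" if "x \<in> A" for x
        using norm_blinfun[of T x] that by (simp add: A_def)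
    qed
    consider "A = {}" | "(SUP x\<in>A. norm (T x)) < norm T"
      using assms(4)[of "\<eta> / 4"] \<eta> by (auto simp: Let_def A_def)
    then show ?thesis
    proof cases
      case 1
      then show ?thesis using in_A by (intro exI[of _ 1]) auto
    next
      case 2
      then show ?thesis using cSUP_upper[OF in_A bdd]
        by (intro exI[of _ "norm T - (SUP x\<in>A. norm (T x))"]) simp
    qed
  qed
  have y: "T x0 \<noteq> 0" using assms(3) by (simp add: smooth_def)
  obtain g :: "'b \<Rightarrow>\<^sub>L real" where g: "norm g = 1" "g (T x0) = norm (T x0)"
    using smooth_iff[OF y] assms(3) by blast
  have upper: "F S \<le> g (S x0)" if F: "norm F = 1" "F T = norm T"
    for F :: "('a \<Rightarrow>\<^sub>L 'b) \<Rightarrow>\<^sub>L real" and S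
  proof (rule field_le_epsilon)
    fix e :: real assume "e > 0"
    \<comment> \<open>One half is spent on the derivative of the norm at \<open>T x0\<close>, the
      other on replacing \<open>S x\<close> by \<open>S x0\<close>.\<close>
    define \<epsilon> where "\<epsilon> = e / 2"
    have \<epsilon>: "\<epsilon> > 0" using \<open>e > 0\<close> by (simp add: \<epsilon>_def)
    obtain \<eta> s where \<eta>: "\<eta> > 0" and s: "s > 0" and local:
      "\<And>w t. norm (w - T x0) < \<eta> \<Longrightarrow> 0 \<le> t \<Longrightarrow> t \<le> s \<Longrightarrow>
        norm (w + t *\<^sub>R S x0) \<le> norm w + t * (g (S x0) + \<epsilon>)"
      using smooth_norm_upper_derivative_locally[OF assms(3) g, of "S x0" "g (S x0) + \<epsilon>"] \<epsilon>
      by auto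
    \<comment> \<open>Within \<rho> of \<open>x0\<close>, \<open>T x\<close> is \<eta>-close to
      \<open>T x0\<close> and \<open>S x\<close> is \<epsilon>-close to \<open>S x0\<close>; adding
      1 avoids zero denominators.\<close>
    define \<rho> where "\<rho> = min (\<eta> / (norm T + 1)) (\<epsilon> / (norm S + 1))"
    have \<rho>: "\<rho> > 0" using \<eta> \<epsilon> by (simp add: \<rho>_def add_nonneg_pos)
    have near: "norm ((T + t *\<^sub>R S) x) \<le> norm T + t * (g (S x0) + e)"
      if x: "norm x = 1" "norm (x - x0) < \<rho>" and t: "0 \<le> t" "t \<le> s" for x t
    proof -
      have "norm (T x - T x0) \<le> norm T * norm (x - x0)"
        using norm_blinfun[of T "x - x0"] by (simp add: blinfun.diff_right)
      also have "\<dots> \<le> (norm T + 1) * norm (x - x0)" by (intro mult_right_mono) auto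
      also have "\<dots> < \<eta>" using x(2) by (simp add: \<rho>_def pos_less_divide_eq add_nonneg_pos mult.commute)
      finally have 1: "norm (T x + t *\<^sub>R S x0) \<le> norm (T x) + t * (g (S x0) + \<epsilon>)"
        using local t by blast
      have "norm (S x - S x0) \<le> norm S * norm (x - x0)"
        using norm_blinfun[of S "x - x0"] by (simp add: blinfun.diff_right)
      also have "\<dots> \<le> (norm S + 1) * norm (x - x0)" by (intro mult_right_mono) auto
      also have "\<dots> < \<epsilon>" using x(2) by (simp add: \<rho>_def pos_less_divide_eq add_nonneg_pos mult.commute)
      finally have 2: "t * norm (S x - S x0) \<le> t * \<epsilon>" using t by (intro mult_left_mono) auto
      have "(T + t *\<^sub>R S) x = (T x + t *\<^sub>R S x0) + t *\<^sub>R (S x - S x0)"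
        by (simp add: blinfun.add_left blinfun.scaleR_left algebra_simps)
      then have "norm ((T + t *\<^sub>R S) x) \<le> norm (T x + t *\<^sub>R S x0) + t * norm (S x - S x0)"
        using norm_triangle_ineq[of "T x + t *\<^sub>R S x0" "t *\<^sub>R (S x - S x0)"] t by simp
      also have "\<dots> \<le> norm (T x) + t * (g (S x0) + \<epsilon>) + t * \<epsilon>" using 1 2 by linarith
      also have "\<dots> \<le> norm T + t * (g (S x0) + e)"
        using norm_blinfun[of T x] x(1) by (simp add: \<epsilon>_def algebra_simps)
      finally show ?thesis .
    qed
    obtain \<kappa> where \<kappa>: "\<kappa> > 0" and far: "\<And>x. norm x = 1 \<Longrightarrow> \<rho> \<le> norm (x - x0) \<Longrightarrow>
        \<rho> \<le> norm (x + x0) \<Longrightarrow> norm (T x) \<le> norm T - \<kappa>"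
      using gap[OF \<rho>] by blast
    \<comment> \<open>Away from \<plusminus>x0 the gap \<kappa> must absorb
      \<open>t * norm S\<close> twice: as growth of the left side and as a possible negative value
      of \<open>t * g (S x0)\<close>.\<close>
    define t where "t = min s (\<kappa> / (2 * norm S + 1))"
    have t: "0 < t" "t \<le> s" using s \<kappa> by (auto simp: t_def add_nonneg_pos)
    have "t \<le> \<kappa> / (2 * norm S + 1)" by (simp add: t_def)
    then have "t * (2 * norm S + 1) \<le> \<kappa>" by (simp add: pos_le_divide_eq add_nonneg_pos)
    then have t\<kappa>: "2 * (t * norm S) \<le> \<kappa>" using t by (simp add: algebra_simps)
    have gS: "\<bar>g (S x0)\<bar> \<le> norm S"
      using norm_blinfun[of g "S x0"] norm_blinfun[of S x0] g(1) x0 by simp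
    have unit: "norm ((T + t *\<^sub>R S) x) \<le> norm T + t * (g (S x0) + e)" if x: "norm x = 1" for x
    proof -
      consider "norm (x - x0) < \<rho>" | "norm (x + x0) < \<rho>" | "\<rho> \<le> norm (x - x0)" "\<rho> \<le> norm (x + x0)"
        by linarith
      then show ?thesis
      proof cases
        case 1
        then show ?thesis using near x t by simp
      next
        case 2
        \<comment> \<open>By oddness of the operator, points near \<open>- x0\<close> reduce to
          points near \<open>x0\<close>.\<close>
        then have "norm (- x - x0) < \<rho>" by (simp add: norm_minus_commute[of "- x"] add.commute)
        then show ?thesis using near[of "- x" t] x t by (simp add: blinfun.minus_right)
      next
        case 3
        have "norm ((T + t *\<^sub>R S) x) \<le> norm (T x) + t * norm (S x)"
          using norm_triangle_ineq[of "T x" "t *\<^sub>R S x"] t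
          by (simp add: blinfun.add_left blinfun.scaleR_left)
        moreover have "t * norm (S x) \<le> t * norm S"
          using norm_blinfun[of S x] x t by (intro mult_left_mono) auto
        moreover have "t * (- norm S) \<le> t * (g (S x0) + e)"
          using gS \<open>e > 0\<close> t by (intro mult_left_mono) auto
        ultimately show ?thesis using far[OF x 3] t\<kappa> by simp
      qed
    qed
    have nonneg: "0 \<le> norm T + t * (g (S x0) + e)"
      using unit[OF x0] norm_ge_zero order_trans by blast
    have "norm (T + t *\<^sub>R S) \<le> norm T + t * (g (S x0) + e)"
    proof (rule norm_blinfun_bound[OF nonneg])
      fix x
      show "norm ((T + t *\<^sub>R S) x) \<le> (norm T + t * (g (S x0) + e)) * norm x"
      proof (cases "x = 0")
        case False
        then show ?thesis using unit[of "x /\<^sub>R norm x"]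
          by (simp add: blinfun.scaleR_right pos_divide_le_eq divide_inverse_commute[symmetric])
      qed simp
    qed
    \<comment> \<open>The left side is \<open>F (T + t *\<^sub>R S)\<close>, and \<open>F\<close>
      has norm one.\<close>
    moreover have "norm T + t * F S \<le> norm (T + t *\<^sub>R S)"
      using norm_blinfun[of F "T + t *\<^sub>R S"] F by (simp add: blinfun.add_right blinfun.scaleR_right)
    ultimately have "t * F S \<le> t * (g (S x0) + e)" by linarith
    then show "F S \<le> g (S x0) + e" using t by simp
  qed
  \<comment> \<open>The bound at \<open>- S\<close> supplies the reverse inequality.\<close>
  have eq: "F S = g (S x0)" if "norm F = 1" "F T = norm T"
    for F :: "('a \<Rightarrow>\<^sub>L 'b) \<Rightarrow>\<^sub>L real" and S
    using upper[OF that, of S] upper[OF that, of "- S"]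
    by (simp add: blinfun.minus_left blinfun.minus_right)
  \<comment> \<open>Evaluation at \<open>x0\<close> followed by \<open>g\<close> is the one
    remaining candidate, which settles existence.\<close>
  define G :: "('a \<Rightarrow>\<^sub>L 'b) \<Rightarrow>\<^sub>L real" where "G = Blinfun (\<lambda>S. g (blinfun_apply S x0))"
  have G: "G S = g (S x0)" for S :: "'a \<Rightarrow>\<^sub>L 'b"
    unfolding G_def
    by (subst bounded_linear_Blinfun_apply) (auto intro!: bounded_linear_intros)
  have GT: "G T = norm T" by (simp add: G g Tx0)
  have "norm G \<le> 1"
  proof (rule norm_blinfun_bound)
    fix S
    show "norm (G S) \<le> 1 * norm S"
      using norm_blinfun[of g "S x0"] norm_blinfun[of S x0] g(1) x0 by (simp add: G)
  qed simp
  moreover have "1 \<le> norm G" using norm_blinfun[of G T] T by (simp add: GT)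
  ultimately have "norm G = 1" by simp
  then have "\<exists>!F :: ('a \<Rightarrow>\<^sub>L 'b) \<Rightarrow>\<^sub>L real. norm F = 1 \<and> blinfun_apply F T = norm T"
    using GT eq G by (intro ex1I[of _ G] blinfun_eqI) auto
  then show ?thesis using smooth_iff[OF T] by blast
qed

end
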